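(* Let $t\mapsto(R(t),x(t))$ be a trajectory of the system $$\dot R(t)=R(t)\widehat{x}(t),\qquad \dot x(t)=f(x(t),R(t)),$$ with $R(t)\in\mathsf{SO}(n)_{\mathrm{reg}}$, and let $X(t)=\mathrm{Log}(R(t))$. Then $$\dot X(t)=(\mathrm{d}^\ell\mathrm{Exp}_{X(t)})^{-1}[\widehat{x}(t)],$$ where, for $X\in\mathfrak{so}(n)$, the left-trivialized differential of the exponential map $\mathrm{d}^\ell\mathrm{Exp}_X:\mathfrak{so}(n)\to\mathfrak{so}(n)$ is the linear map $$\mathrm{d}^\ell\mathrm{Exp}_X[\Delta]=\int_0^1 e^{-sX}\,\Delta\, e^{sX}\,ds,\qquad \Delta\in\mathfrak{so}(n),$$ and $(\mathrm{d}^\ell\mathrm{Exp}_{X(t)})^{-1}$ is the inverse linear map (its existence being part of the assertion).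
   Context: Let $n\ge 2$ and $m_n=n(n-1)/2$. $\mathsf{SO}(n)=\{R\in\mathbb{R}^{n\times n}: R^\top R=I_n,\ \det R=1\}$, and $\mathfrak{so}(n)$ is the space of real skew-symmetric $n\times n$ matrices. The hat map $\widehat{(\cdot)}:\mathbb{R}^{m_n}\to\mathfrak{so}(n)$ is a fixed linear isomorphism; $\widehat{x}(t)$ means the hat map applied to $x(t)$. Let $\mathcal{D}_n=\{\omega\in\mathbb{R}^{m_n}:\|\widehat\omega\|_2<\pi\}$ ($\|\cdot\|_2$ the spectral norm) and $\mathsf{SO}(n)_{\mathrm{reg}}=\{\mathrm{Exp}(\widehat\omega):\omega\in\mathcal{D}_n\}=\{R\in\mathsf{SO}(n): -1\notin\mathrm{spec}(R)\}$, where $\mathrm{Exp}$ is the matrix exponential. $\mathrm{Log}$ is the inverse of $\mathrm{Exp}$ from $\mathsf{SO}(n)_{\mathrm{reg}}$ to $\{\widehat\omega:\omega\in\mathcal{D}_n\}$. The state is $(R,x)\in\mathsf{SO}(n)\times\mathcal{X}$, where $\mathcal{X}\subset\mathbb{R}^{m_n}$ is a compact connected domain containing the origin, and $f$ takes $x\in\mathcal{X}$, $R\in\mathsf{SO}(n)$ to $f(x,R)\in\mathbb{R}^{m_n}$; a unique forward-complete solution is assumed to exist for every initial condition in $\mathsf{SO}(n)\times\mathcal{X}$. *)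

theory Defs
  imports "HOL-Analysis.Analysis"
begin

text \<open>On the type \<open>real ^ 'n ^ 'n\<close> the class operations \<open>(*)\<close>, \<open>(^)\<close> act entrywise, so the
  generic \<open>exp\<close> is not available; the exponential series is written with the matrix product.\<close>

definition mat_pow :: "real ^ 'n ^ 'n \<Rightarrow> nat \<Rightarrow> real ^ 'n ^ 'n" where
  "mat_pow A k = (((**) A) ^^ k) (mat 1)"

definition mexp :: "real ^ 'n ^ 'n \<Rightarrow> real ^ 'n ^ 'n" where
  "mexp A = (\<Sum>k. (1 / fact k) *\<^sub>R mat_pow A k)"

definition SO :: "(real ^ 'n ^ 'n) set" where
  "SO = {R. transpose R ** R = mat 1 \<and> det R = 1}"

definition so :: "(real ^ 'n ^ 'n) set" where
  "so = {A. transpose A = - A}"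

definition spectral_norm :: "real ^ 'n ^ 'n \<Rightarrow> real" where
  "spectral_norm A = onorm ((*v) A)"

definition hat_map :: "(real ^ 'm \<Rightarrow> real ^ 'n ^ 'n) \<Rightarrow> bool" where
  "hat_map hat \<longleftrightarrow> linear hat \<and> bij_betw hat UNIV so"

definition log_coords :: "(real ^ 'm \<Rightarrow> real ^ 'n ^ 'n) \<Rightarrow> (real ^ 'm) set" where
  "log_coords hat = {\<omega>. spectral_norm (hat \<omega>) < pi}"

definition SO_reg :: "(real ^ 'm \<Rightarrow> real ^ 'n ^ 'n) \<Rightarrow> (real ^ 'n ^ 'n) set" where
  "SO_reg hat = {mexp (hat \<omega>) | \<omega>. \<omega> \<in> log_coords hat}"

definition Log :: "(real ^ 'm \<Rightarrow> real ^ 'n ^ 'n) \<Rightarrow> real ^ 'n ^ 'n \<Rightarrow> real ^ 'n ^ 'n" where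
  "Log hat = the_inv_into (hat ` log_coords hat) mexp"

definition dexp_left :: "real ^ 'n ^ 'n \<Rightarrow> real ^ 'n ^ 'n \<Rightarrow> real ^ 'n ^ 'n" where
  "dexp_left X \<Delta> = integral {0..1} (\<lambda>s. mexp (- (s *\<^sub>R X)) ** \<Delta> ** mexp (s *\<^sub>R X))"

text \<open>Trajectories live on the time axis \<open>[0, \<infinity>)\<close> and stay in the state space \<open>SO \<times> \<X>\<close>;
  the derivative at time \<open>0\<close> is one-sided.\<close>

definition trajectory ::
  "(real ^ 'm \<Rightarrow> real ^ 'n ^ 'n) \<Rightarrow> (real ^ 'm) set \<Rightarrow> (real ^ 'm \<Rightarrow> real ^ 'n ^ 'n \<Rightarrow> real ^ 'm)
    \<Rightarrow> (real \<Rightarrow> real ^ 'n ^ 'n) \<Rightarrow> (real \<Rightarrow> real ^ 'm) \<Rightarrow> bool" where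
  "trajectory hat \<X> f R x \<longleftrightarrow>
    (\<forall>t\<ge>0. R t \<in> SO \<and> x t \<in> \<X> \<and>
      (R has_vector_derivative R t ** hat (x t)) (at t within {0..}) \<and>
      (x has_vector_derivative f (x t) (R t)) (at t within {0..}))"

definition unique_forward_complete ::
  "(real ^ 'm \<Rightarrow> real ^ 'n ^ 'n) \<Rightarrow> (real ^ 'm) set \<Rightarrow> (real ^ 'm \<Rightarrow> real ^ 'n ^ 'n \<Rightarrow> real ^ 'm)
    \<Rightarrow> bool" where
  "unique_forward_complete hat \<X> f \<longleftrightarrow>
    (\<forall>R0\<in>SO. \<forall>x0\<in>\<X>.
      (\<exists>R x. trajectory hat \<X> f R x \<and> R 0 = R0 \<and> x 0 = x0) \<and>
      (\<forall>R x R' x'. trajectory hat \<X> f R x \<and> R 0 = R0 \<and> x 0 = x0 \<and>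
                   trajectory hat \<X> f R' x' \<and> R' 0 = R0 \<and> x' 0 = x0
        \<longrightarrow> (\<forall>t\<ge>0. R t = R' t \<and> x t = x' t)))"

end

theory Submission
  imports Defs
begin

text \<open>Duhamel's formula makes the exponential continuously differentiable on the space of all
  matrices, with derivative \<open>\<Delta> \<mapsto> exp X (d\<^sup>l Exp\<^sub>X \<Delta>)\<close> at \<open>X\<close>.  The key fact is that, for
  skew-symmetric \<open>A\<close> and \<open>B\<close> of spectral norm below \<open>\<pi>\<close>, \<open>exp A \<Delta> = \<Delta> exp B\<close> forces
  \<open>A \<Delta> = \<Delta> B\<close>: the relation passes to \<open>A/2\<close> and \<open>B/2\<close>, because \<open>exp (A/2)\<close> has positive
  definite symmetric part and is therefore determined by \<open>exp A\<close>, and so to \<open>A/2\<^sup>k\<close> and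
  \<open>B/2\<^sup>k\<close> for all \<open>k\<close>; now differentiate at \<open>0\<close>.  With \<open>\<Delta> = 1\<close> this is injectivity of the
  exponential; with \<open>A = B = X\<close> it shows that an element of the kernel of the differential
  commutes with \<open>X\<close> and hence vanishes.  The inverse function theorem on the space of all
  matrices then yields the derivative of the logarithm.\<close>

section \<open>The matrix exponential\<close>

lemma matrix_add_rdistrib: "(A + B) ** C = A ** C + B ** (C :: 'a::semiring_1 ^ 'p ^ 'm)"
  by (simp add: matrix_matrix_mult_def vec_eq_iff sum.distrib distrib_right)

lemma bounded_bilinear_matrix_mult:
  "bounded_bilinear ((**) :: real ^ 'n ^ 'n \<Rightarrow> real ^ 'n ^ 'n \<Rightarrow> real ^ 'n ^ 'n)"
proof -
  have "bilinear ((**) :: real ^ 'n ^ 'n \<Rightarrow> real ^ 'n ^ 'n \<Rightarrow> real ^ 'n ^ 'n)"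
    unfolding bilinear_def
    by (auto intro!: linearI simp: matrix_add_ldistrib matrix_scalar_ac
        matrix_add_rdistrib scalar_matrix_assoc[symmetric])
  then show ?thesis
    by (simp add: bilinear_conv_bounded_bilinear)
qed

interpretation matrix_mult:
  bounded_bilinear "(**) :: real ^ 'n ^ 'n \<Rightarrow> real ^ 'n ^ 'n \<Rightarrow> real ^ 'n ^ 'n"
  by (rule bounded_bilinear_matrix_mult)

lemma linear_transpose: "linear (transpose :: real ^ 'n ^ 'm \<Rightarrow> real ^ 'm ^ 'n)"
  by (rule linearI) (simp_all add: transpose_def vec_eq_iff)

lemma bounded_linear_transpose:
  "bounded_linear (transpose :: real ^ 'n ^ 'm \<Rightarrow> real ^ 'm ^ 'n)"
  using linear_transpose linear_conv_bounded_linear by blast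

lemma transpose_uminus: "transpose (- A) = - transpose (A :: real ^ 'n ^ 'm)"
  by (rule linear_neg[OF linear_transpose])

lemma mat_pow_0 [simp]: "mat_pow A 0 = mat 1"
  and mat_pow_Suc [simp]: "mat_pow A (Suc k) = A ** mat_pow A k"
  by (simp_all add: mat_pow_def)

lemma mat_pow_scaleR: "mat_pow (s *\<^sub>R A) k = s ^ k *\<^sub>R mat_pow A k"
  by (induction k) (simp_all add: matrix_mult.scaleR_left matrix_mult.scaleR_right mult.commute)

lemma mat_pow_Suc2: "mat_pow A (Suc k) = mat_pow A k ** A"
  by (induction k) (simp_all add: matrix_mul_assoc)

lemma transpose_mat_pow: "transpose (mat_pow A k) = mat_pow (transpose A) k"
  for A :: "real ^ 'n ^ 'n"
proof (induction k)
  case (Suc k)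
  have "transpose (mat_pow A (Suc k)) = transpose A ** transpose (mat_pow A k)"
    by (simp only: mat_pow_Suc2 matrix_transpose_mul)
  with Suc show ?case
    by simp
qed simp

text \<open>Each multiplication by \<open>A\<close> costs one factor \<open>K * norm A\<close>,
  where \<open>K\<close> bounds the bilinear product. The exponential series is thereby dominated by
  a multiple of the real series of \<open>exp (K * norm A)\<close>.\<close>

lemma norm_mat_pow_le:
  obtains K where "K \<ge> 0"
    "\<And>(A :: real ^ 'n ^ 'n) k. norm (mat_pow A k) \<le> norm (mat 1 :: real ^ 'n ^ 'n) * (K * norm A) ^ k"
proof -
  obtain K where K: "K \<ge> 0" "\<And>(A :: real ^ 'n ^ 'n) (B :: real ^ 'n ^ 'n). norm (A ** B) \<le> norm A * norm B * K"
    using bounded_bilinear.nonneg_bounded[OF bounded_bilinear_matrix_mult[where 'n = 'n]] by metis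
  have "norm (mat_pow A k) \<le> norm (mat 1 :: real ^ 'n ^ 'n) * (K * norm A) ^ k"
    for A :: "real ^ 'n ^ 'n" and k
  proof (induction k)
    case (Suc k)
    have "norm (mat_pow A (Suc k)) \<le> (norm A * K) * norm (mat_pow A k)"
      using K(2)[of A "mat_pow A k"] by (simp add: ac_simps)
    also have "\<dots> \<le> (norm A * K) * (norm (mat 1 :: real ^ 'n ^ 'n) * (K * norm A) ^ k)"
      by (intro mult_left_mono Suc) (simp add: K)
    finally show ?case
      by (simp add: ac_simps)
  qed simp
  with K(1) show ?thesis
    by (rule that)
qed

lemma mexp_sums: "(\<lambda>k. (1 / fact k) *\<^sub>R mat_pow A k) sums mexp A" (is ?sums)
  and norm_mexp_le_suminf:
    "norm (mexp A) \<le> (\<Sum>k. norm ((1 / fact k) *\<^sub>R mat_pow A k))" (is ?le)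
  and summable_norm_mexp: "summable (\<lambda>k. norm ((1 / fact k) *\<^sub>R mat_pow A k))" (is ?summable)
  for A :: "real ^ 'n ^ 'n"
proof -
  obtain K where K:
    "\<And>(A :: real ^ 'n ^ 'n) k. norm (mat_pow A k) \<le> norm (mat 1 :: real ^ 'n ^ 'n) * (K * norm A) ^ k"
    using norm_mat_pow_le by metis
  have le: "norm (norm ((1 / fact k) *\<^sub>R mat_pow A k))
      \<le> norm (mat 1 :: real ^ 'n ^ 'n) * ((K * norm A) ^ k /\<^sub>R fact k)" for k
    using mult_left_mono[OF K[of A k], of "1 / fact k"] by (simp add: field_simps)
  show ?summable
    by (rule summable_comparison_test'[OF summable_mult[OF sums_summable[OF exp_converges]] le])
  then show ?sums ?le
    unfolding mexp_def by (blast intro: summable_sums summable_norm_cancel summable_norm)+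
qed

lemma norm_mexp_le:
  obtains M K where "K \<ge> 0" "M \<ge> 0" "\<And>A :: real ^ 'n ^ 'n. norm (mexp A) \<le> M * exp (K * norm A)"
proof -
  let ?M = "norm (mat 1 :: real ^ 'n ^ 'n)"
  obtain K where K: "K \<ge> 0"
    "\<And>(A :: real ^ 'n ^ 'n) k. norm (mat_pow A k) \<le> ?M * (K * norm A) ^ k"
    using norm_mat_pow_le by metis
  have "norm (mexp A) \<le> ?M * exp (K * norm A)" for A :: "real ^ 'n ^ 'n"
  proof -
    have s: "(\<lambda>k. ?M * ((K * norm A) ^ k /\<^sub>R fact k)) sums (?M * exp (K * norm A))"
      by (intro sums_mult exp_converges)
    have le: "norm ((1 / fact k) *\<^sub>R mat_pow A k) \<le> ?M * ((K * norm A) ^ k /\<^sub>R fact k)" for k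
      using mult_left_mono[OF K(2)[of A k], of "1 / fact k"] by (simp add: field_simps)
    have "(\<Sum>k. norm ((1 / fact k) *\<^sub>R mat_pow A k)) \<le> (\<Sum>k. ?M * ((K * norm A) ^ k /\<^sub>R fact k))"
      by (rule suminf_le[OF le summable_norm_mexp sums_summable[OF s]])
    with norm_mexp_le_suminf[of A] sums_unique[OF s] show ?thesis
      by linarith
  qed
  with K(1) show ?thesis
    by (rule_tac that[of K ?M]) auto
qed

lemma mexp_0 [simp]: "mexp 0 = (mat 1 :: real ^ 'n ^ 'n)"
proof -
  have "(\<lambda>k. (1 / fact k) *\<^sub>R mat_pow (0 :: real ^ 'n ^ 'n) k) = (\<lambda>k. if k = 0 then mat 1 else 0)"
  proof
    show "(1 / fact k) *\<^sub>R mat_pow (0 :: real ^ 'n ^ 'n) k = (if k = 0 then mat 1 else 0)" for k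
      by (cases k) (simp_all add: matrix_mult.zero_left)
  qed
  then have "(\<lambda>k. (1 / fact k) *\<^sub>R mat_pow 0 k) sums (mat 1 :: real ^ 'n ^ 'n)"
    using sums_single[of 0 "\<lambda>_. mat 1 :: real ^ 'n ^ 'n"] by simp
  then show ?thesis
    using mexp_sums sums_unique2 by blast
qed

lemma transpose_mexp: "transpose (mexp A) = mexp (transpose A)"
  for A :: "real ^ 'n ^ 'n"
proof -
  have "(\<lambda>k. transpose ((1 / fact k) *\<^sub>R mat_pow A k)) sums transpose (mexp A)"
    by (rule bounded_linear.sums[OF bounded_linear_transpose mexp_sums])
  then have "(\<lambda>k. (1 / fact k) *\<^sub>R mat_pow (transpose A) k) sums transpose (mexp A)"
    by (simp add: transpose_scalar transpose_mat_pow)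
  then show ?thesis
    using mexp_sums sums_unique2 by blast
qed

lemma mexp_commute: "A ** mexp A = mexp A ** A"
proof -
  have "A ** ((1 / fact k) *\<^sub>R mat_pow A k) = ((1 / fact k) *\<^sub>R mat_pow A k) ** A" for k
    using mat_pow_Suc2[of A k] by (simp add: matrix_mult.scaleR_left matrix_mult.scaleR_right)
  then show ?thesis
    using bounded_linear.sums[OF matrix_mult.bounded_linear_left mexp_sums[of A], of A]
      bounded_linear.sums[OF matrix_mult.bounded_linear_right mexp_sums[of A], of A]
      sums_unique2 by simp
qed

lemma mexp_commute_scaleR: "A ** mexp (s *\<^sub>R A) = mexp (s *\<^sub>R A) ** A"
  by (cases "s = 0") (use mexp_commute[of "s *\<^sub>R A"] in
      \<open>simp_all add: matrix_mult.scaleR_left matrix_mult.scaleR_right\<close>)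

section \<open>The one-parameter groups \<open>mexp (s *\<^sub>R A)\<close>\<close>

text \<open>Pairing with a fixed \<open>b\<close> gives an everywhere convergent real power series
  in \<open>s\<close>, which may be differentiated term by term; in finite dimension such
  coordinates suffice.\<close>

lemma mexp_scaleR_has_vector_derivative:
  "((\<lambda>s. mexp (s *\<^sub>R A)) has_vector_derivative A ** mexp (s *\<^sub>R A)) (at s within S)"
proof -
  have comp: "((\<lambda>s. mexp (s *\<^sub>R A) \<bullet> b) has_real_derivative (A ** mexp (s *\<^sub>R A)) \<bullet> b) (at s)" for b
  proof -
    define c where "c = (\<lambda>k. ((1 / fact k) *\<^sub>R mat_pow A k) \<bullet> b)"
    have 1: "(\<lambda>k. c k * u ^ k) sums (mexp (u *\<^sub>R A) \<bullet> b)" for u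
      using bounded_linear.sums[OF bounded_linear_inner_left mexp_sums[of "u *\<^sub>R A"], of b]
      by (simp add: c_def mat_pow_scaleR field_simps)
    have 2: "(\<lambda>k. diffs c k * u ^ k) sums ((A ** mexp (u *\<^sub>R A)) \<bullet> b)" for u
    proof -
      have "(A ** ((1 / fact k) *\<^sub>R mat_pow (u *\<^sub>R A) k)) \<bullet> b = diffs c k * u ^ k" for k
        by (simp add: c_def diffs_def mat_pow_scaleR matrix_mult.scaleR_right del: of_nat_Suc)
      then show ?thesis
        using bounded_linear.sums[OF bounded_linear_inner_left
            bounded_linear.sums[OF matrix_mult.bounded_linear_right mexp_sums[of "u *\<^sub>R A"], of A], of b]
        by simp
    qed
    have "((\<lambda>u. \<Sum>k. c k * u ^ k) has_real_derivative (\<Sum>k. diffs c k * s ^ k)) (at s)"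
      by (rule termdiffs_strong_converges_everywhere) (use 1 sums_summable in blast)
    then show ?thesis
      using 1 2 by (simp add: sums_iff)
  qed
  have "((\<lambda>s. mexp (s *\<^sub>R A)) has_vector_derivative A ** mexp (s *\<^sub>R A)) (at s)"
    unfolding has_vector_derivative_def
    by (subst has_derivative_componentwise_within)
       (use comp in \<open>auto simp: has_field_derivative_def mult_commute_abs\<close>)
  then show ?thesis
    by (rule has_vector_derivative_at_within)
qed

lemma mexp_diff_scaleR_has_vector_derivative:
  "((\<lambda>s. mexp ((c - s) *\<^sub>R A)) has_vector_derivative - (mexp ((c - s) *\<^sub>R A) ** A)) (at s within S)"
proof -
  have "((\<lambda>s. mexp (s *\<^sub>R A)) \<circ> (\<lambda>s. c - s) has_vector_derivative
      (- 1) *\<^sub>R (A ** mexp ((c - s) *\<^sub>R A))) (at s within S)"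
    by (rule vector_diff_chain_within[OF _ mexp_scaleR_has_vector_derivative])
       (auto intro!: derivative_eq_intros)
  then show ?thesis
    by (simp add: comp_def mexp_commute_scaleR)
qed

text \<open>The curve joins \<open>mexp (c *\<^sub>R A)\<close> at \<open>s = 0\<close> to
  \<open>mexp (c *\<^sub>R B)\<close> at \<open>s = c\<close>. For \<open>A = B\<close> it is
  constant, which gives the group law; for \<open>c = 1\<close>, integrating its derivative gives
  Duhamel's formula.\<close>

lemma mexp_interpolation_has_vector_derivative:
  "((\<lambda>s. mexp ((c - s) *\<^sub>R A) ** mexp (s *\<^sub>R B)) has_vector_derivative
      mexp ((c - s) *\<^sub>R A) ** (B - A) ** mexp (s *\<^sub>R B)) (at s within S)"
  using matrix_mult.has_vector_derivative[OF
      mexp_diff_scaleR_has_vector_derivative mexp_scaleR_has_vector_derivative]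
  by (rule has_vector_derivative_eq_rhs)
     (simp add: matrix_mul_assoc matrix_mult.diff_left matrix_mult.diff_right matrix_mult.minus_left)

lemma mexp_add_scaleR: "mexp (s *\<^sub>R A) ** mexp (t *\<^sub>R A) = mexp ((s + t) *\<^sub>R A)"
proof -
  have "((\<lambda>u. mexp (((s + t) - u) *\<^sub>R A) ** mexp (u *\<^sub>R A)) has_derivative (\<lambda>h. 0)) (at u within UNIV)"
    for u
    using mexp_interpolation_has_vector_derivative[of "s + t" A A u UNIV]
    by (simp add: has_vector_derivative_def matrix_mult.zero_left matrix_mult.zero_right)
  from has_derivative_zero_unique[OF convex_UNIV this, of t 0]
  have "mexp ((s + t - t) *\<^sub>R A) ** mexp (t *\<^sub>R A) = mexp ((s + t - 0) *\<^sub>R A) ** mexp (0 *\<^sub>R A)"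
    by simp
  then show ?thesis
    by simp
qed

lemma mexp_minus_mult: "mexp (- A) ** mexp A = mat 1" "mexp A ** mexp (- A) = mat 1"
  using mexp_add_scaleR[of "-1" A 1] mexp_add_scaleR[of 1 A "-1"] by simp_all

lemma mexp_half_mult: "mexp ((1/2) *\<^sub>R A) ** mexp ((1/2) *\<^sub>R A) = mexp A"
  using mexp_add_scaleR[of "1/2" A "1/2"] by simp

section \<open>The differential of the exponential\<close>

lemma mexp_duhamel:
  "((\<lambda>s. mexp ((1 - s) *\<^sub>R A) ** (B - A) ** mexp (s *\<^sub>R B)) has_integral mexp B - mexp A) {0..1}"
proof -
  have "((\<lambda>s. mexp ((1 - s) *\<^sub>R A) ** (B - A) ** mexp (s *\<^sub>R B)) has_integral
      mexp ((1 - 1) *\<^sub>R A) ** mexp (1 *\<^sub>R B) - mexp ((1 - 0) *\<^sub>R A) ** mexp (0 *\<^sub>R B)) {0..1}"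
    by (rule fundamental_theorem_of_calculus) (simp_all add: mexp_interpolation_has_vector_derivative)
  then show ?thesis
    by simp
qed

text \<open>The outer factors in Duhamel's integrand are locally bounded, so the increment of
  \<open>mexp\<close> is at most a locally bounded multiple of \<open>norm (B - A)\<close>.\<close>

lemma isCont_mexp: "isCont mexp (A :: real ^ 'n ^ 'n)"
proof -
  obtain M K where K: "K \<ge> 0" and M: "M \<ge> 0"
    and le: "\<And>A :: real ^ 'n ^ 'n. norm (mexp A) \<le> M * exp (K * norm A)"
    using norm_mexp_le by metis
  obtain L where L: "L \<ge> 0"
    "\<And>(A :: real ^ 'n ^ 'n) (B :: real ^ 'n ^ 'n). norm (A ** B) \<le> norm A * norm B * L"
    using bounded_bilinear.nonneg_bounded[OF bounded_bilinear_matrix_mult[where 'n = 'n]] by metis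
  define b where "b = (\<lambda>B :: real ^ 'n ^ 'n.
    (M * exp (K * norm A)) * norm (B - A) * L * (M * exp (K * norm B)) * L)"
  have "norm (mexp B - mexp A) \<le> b B" for B
  proof -
    have bound: "norm (mexp ((1 - s) *\<^sub>R A) ** (B - A) ** mexp (s *\<^sub>R B)) \<le> b B"
      if "s \<in> {0..1}" for s
    proof -
      have "norm (mexp (r *\<^sub>R C)) \<le> M * exp (K * norm C)" if "r \<in> {0..1}" for r and C :: "real ^ 'n ^ 'n"
        using K M that by (intro order_trans[OF le] mult_left_mono) (auto intro!: mult_left_mono mult_left_le_one_le)
      then have "norm (mexp ((1 - s) *\<^sub>R A)) \<le> M * exp (K * norm A)"
        "norm (mexp (s *\<^sub>R B)) \<le> M * exp (K * norm B)"
        using that by auto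
      then show ?thesis
        unfolding b_def using L(1) M
        by (intro order_trans[OF L(2)] mult_right_mono mult_mono) auto
    qed
    have "0 \<le> b B"
      using L(1) M by (simp add: b_def)
    from has_integral_bound_real[OF this finite.emptyI mexp_duhamel[of A B]] bound
    show ?thesis
      by simp
  qed
  moreover have "isCont b A"
    unfolding b_def by (intro continuous_intros)
  then have "(b \<longlongrightarrow> 0) (at A)"
    by (simp add: isCont_def b_def)
  ultimately have "((\<lambda>B. mexp B - mexp A) \<longlongrightarrow> 0) (at A)"
    by (rule_tac Lim_null_comparison[where g = b]) simp_all
  then show ?thesis
    unfolding isCont_def by (rule LIM_zero_cancel)
qed

lemma continuous_on_mexp [continuous_intros]:
  "continuous_on S f \<Longrightarrow> continuous_on S (\<lambda>x. mexp (f x))"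
  using isCont_mexp continuous_at_imp_continuous_on[of UNIV mexp]
  by (auto intro: continuous_on_compose2)

section \<open>Continuous differentiability of the exponential\<close>

lemma linear_integral_sandwich:
  fixes P Q :: "real \<Rightarrow> real ^ 'n ^ 'n"
  assumes "continuous_on {0..1} P" "continuous_on {0..1} Q"
  shows "linear (\<lambda>D. integral {0..1} (\<lambda>s. P s ** D ** Q s))"
proof -
  have i: "(\<lambda>s. P s ** D ** Q s) integrable_on {0..1}" for D
    by (intro integrable_continuous_real matrix_mult.continuous_on continuous_intros assms)
  show ?thesis
    by (rule linearI)
      (simp_all add: matrix_mult.add_left matrix_mult.add_right integral_add i
        matrix_mult.scaleR_left matrix_mult.scaleR_right)
qed

text \<open>By Duhamel's formula, \<open>mexp B - mexp A = mexp_slope A B (B - A)\<close>, so that joint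
  continuity of the slope already gives continuous differentiability of the exponential.\<close>

definition mexp_slope :: "real ^ 'n ^ 'n \<Rightarrow> real ^ 'n ^ 'n \<Rightarrow> (real ^ 'n ^ 'n) \<Rightarrow>\<^sub>L (real ^ 'n ^ 'n)" where
  "mexp_slope A B =
    Blinfun (\<lambda>D. integral {0..1} (\<lambda>s. mexp ((1 - s) *\<^sub>R A) ** D ** mexp (s *\<^sub>R B)))"

lemma mexp_slope_apply:
  "mexp_slope A B D = integral {0..1} (\<lambda>s. mexp ((1 - s) *\<^sub>R A) ** D ** mexp (s *\<^sub>R B))"
proof -
  have "linear (\<lambda>D. integral {0..1} (\<lambda>s. mexp ((1 - s) *\<^sub>R A) ** D ** mexp (s *\<^sub>R B)))"
    by (intro linear_integral_sandwich continuous_intros)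
  then show ?thesis
    by (simp add: mexp_slope_def bounded_linear_Blinfun_apply linear_conv_bounded_linear)
qed

lemma mexp_diff_eq_slope: "mexp B - mexp A = mexp_slope A B (B - A)"
  using mexp_duhamel[of A B] by (simp add: mexp_slope_apply integral_unique)

text \<open>In finite dimension, continuity in the operator norm can be tested on basis matrices,
  where it becomes continuity of an integral in its parameters.\<close>

lemma continuous_on_mexp_slope:
  "continuous_on UNIV (\<lambda>(A, B). mexp_slope A B :: (real ^ 'n ^ 'n) \<Rightarrow>\<^sub>L (real ^ 'n ^ 'n))"
proof (rule continuous_on_blinfun_componentwise)
  fix i :: "real ^ 'n ^ 'n"
  have "continuous_on (UNIV \<times> cbox 0 1)
     (\<lambda>(z, s). mexp ((1 - s) *\<^sub>R fst z) ** i ** mexp (s *\<^sub>R snd z))"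
    unfolding case_prod_beta by (intro matrix_mult.continuous_on continuous_intros)
  then have "continuous_on UNIV
     (\<lambda>z. integral (cbox 0 1) (\<lambda>s. mexp ((1 - s) *\<^sub>R fst z) ** i ** mexp (s *\<^sub>R snd z)))"
    by (rule integral_continuous_on_param)
  then show "continuous_on UNIV (\<lambda>z. blinfun_apply (case z of (A, B) \<Rightarrow> mexp_slope A B) i)"
    by (simp add: case_prod_beta mexp_slope_apply)
qed

text \<open>The increment is exactly the slope applied to \<open>B - A\<close>, so the remainder is
  the change of slope applied to \<open>B - A\<close>, and this change tends to zero.\<close>

lemma mexp_has_derivative: "(mexp has_derivative mexp_slope A A) (at A)"
  unfolding has_derivative_within
proof
  have "((\<lambda>B. (\<lambda>(A, B). mexp_slope A B) (A, B)) \<longlongrightarrow> (\<lambda>(A, B). mexp_slope A B) (A, A)) (at A)"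
    by (intro continuous_on_tendsto_compose[OF continuous_on_mexp_slope] tendsto_intros) auto
  then have "((\<lambda>B. norm (mexp_slope A B - mexp_slope A A)) \<longlongrightarrow> 0) (at A)"
    by (simp add: LIM_zero tendsto_norm_zero)
  moreover have "norm ((1 / norm (B - A)) *\<^sub>R (mexp B - (mexp A + mexp_slope A A (B - A))))
      \<le> norm (mexp_slope A B - mexp_slope A A)" if "B \<noteq> A" for B
  proof -
    have "mexp B - (mexp A + mexp_slope A A (B - A)) = (mexp_slope A B - mexp_slope A A) (B - A)"
      using mexp_diff_eq_slope[of B A] by (simp add: blinfun.diff_left algebra_simps)
    then show ?thesis
      using norm_blinfun[of "mexp_slope A B - mexp_slope A A" "B - A"] that
      by (simp add: divide_simps mult.commute)
  qed
  ultimately show "((\<lambda>B. (1 / norm (B - A)) *\<^sub>R (mexp B - (mexp A + mexp_slope A A (B - A)))) \<longlongrightarrow> 0) (at A)"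
    by (rule_tac Lim_null_comparison[where g = "\<lambda>B. norm (mexp_slope A B - mexp_slope A A)"])
       (auto simp: eventually_at_filter)
qed (rule blinfun.bounded_linear_right)

lemma mexp_slope_diag: "mexp_slope X X D = mexp X ** dexp_left X D"
proof -
  have eq: "mexp ((1 - s) *\<^sub>R X) ** D ** mexp (s *\<^sub>R X) =
      mexp X ** (mexp (- (s *\<^sub>R X)) ** D ** mexp (s *\<^sub>R X))" for s
    using mexp_add_scaleR[of 1 X "-s"] by (simp add: matrix_mul_assoc)
  have "(\<lambda>s. mexp (- (s *\<^sub>R X)) ** D ** mexp (s *\<^sub>R X)) integrable_on {0..1}"
    by (intro integrable_continuous_real matrix_mult.continuous_on continuous_intros)
  from integral_linear[OF this matrix_mult.bounded_linear_right[of "mexp X"]] show ?thesis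
    by (simp add: mexp_slope_apply dexp_left_def eq comp_def)
qed

section \<open>The left-trivialized differential, commutators and transposes\<close>

lemma linear_dexp_left: "linear (dexp_left X)"
  unfolding dexp_left_def by (intro linear_integral_sandwich continuous_intros)

lemma mexp_conjugation_has_vector_derivative:
  "((\<lambda>s. mexp (- (s *\<^sub>R X)) ** D ** mexp (s *\<^sub>R X)) has_vector_derivative
     mexp (- (s *\<^sub>R X)) ** (D ** X - X ** D) ** mexp (s *\<^sub>R X)) (at s within S)"
proof -
  have 1: "((\<lambda>s. mexp (- (s *\<^sub>R X)) ** D) has_vector_derivative
      - (mexp (- (s *\<^sub>R X)) ** X ** D)) (at s within S)"
    using bounded_linear.has_vector_derivative[OF matrix_mult.bounded_linear_left
        mexp_diff_scaleR_has_vector_derivative[of 0 X s S], of D]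
    by (simp add: matrix_mult.minus_left)
  show ?thesis
    by (rule has_vector_derivative_eq_rhs[OF
          matrix_mult.has_vector_derivative[OF 1 mexp_scaleR_has_vector_derivative]])
       (simp add: matrix_mult.diff_left matrix_mult.diff_right matrix_mult.minus_left matrix_mul_assoc)
qed

text \<open>For a commutator with \<open>X\<close> the integrand is the derivative of the
  conjugation curve, so the integral is the difference of the end points.\<close>

lemma dexp_left_commutator: "dexp_left X (D ** X - X ** D) = mexp (- X) ** D ** mexp X - D"
proof -
  have "((\<lambda>s. mexp (- (s *\<^sub>R X)) ** (D ** X - X ** D) ** mexp (s *\<^sub>R X)) has_integral
      mexp (- (1 *\<^sub>R X)) ** D ** mexp (1 *\<^sub>R X) - mexp (- (0 *\<^sub>R X)) ** D ** mexp (0 *\<^sub>R X)) {0..1}"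
    by (rule fundamental_theorem_of_calculus) (simp_all add: mexp_conjugation_has_vector_derivative)
  then show ?thesis
    by (simp add: dexp_left_def integral_unique)
qed

text \<open>\<open>X\<close> commutes with its exponentials, so taking the commutator with
  \<open>X\<close> commutes with each conjugation under the integral.\<close>

lemma dexp_left_mult_commutator:
  "dexp_left X (D ** X - X ** D) = dexp_left X D ** X - X ** dexp_left X D"
proof -
  have eq: "mexp (- (s *\<^sub>R X)) ** (D ** X - X ** D) ** mexp (s *\<^sub>R X) =
      (mexp (- (s *\<^sub>R X)) ** D ** mexp (s *\<^sub>R X)) ** X - X ** (mexp (- (s *\<^sub>R X)) ** D ** mexp (s *\<^sub>R X))" for s
  proof -
    have "mexp (- (s *\<^sub>R X)) ** (D ** X) ** mexp (s *\<^sub>R X) = mexp (- (s *\<^sub>R X)) ** D ** mexp (s *\<^sub>R X) ** X"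
      using mexp_commute_scaleR[of X s] by (simp flip: matrix_mul_assoc)
    moreover have "mexp (- (s *\<^sub>R X)) ** (X ** D) ** mexp (s *\<^sub>R X) = X ** (mexp (- (s *\<^sub>R X)) ** D ** mexp (s *\<^sub>R X))"
      using mexp_commute_scaleR[of X "- s"] by (simp add: matrix_mul_assoc)
    ultimately show ?thesis
      by (simp add: matrix_mult.diff_left matrix_mult.diff_right)
  qed
  have i: "((\<lambda>s. mexp (- (s *\<^sub>R X)) ** D ** mexp (s *\<^sub>R X)) has_integral dexp_left X D) {0..1}"
    unfolding dexp_left_def
    by (intro integrable_integral integrable_continuous_real matrix_mult.continuous_on continuous_intros)
  show ?thesis
    unfolding dexp_left_def[of X "D ** X - X ** D"] eq
    using has_integral_diff[OF has_integral_linear[OF i matrix_mult.bounded_linear_left[of X]]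
        has_integral_linear[OF i matrix_mult.bounded_linear_right[of X]]]
    by (intro integral_unique) (simp add: comp_def)
qed

lemma dexp_left_of_commuting:
  assumes "D ** X = X ** D"
  shows "dexp_left X D = D"
proof -
  have "((\<lambda>s. mexp (- (s *\<^sub>R X)) ** D ** mexp (s *\<^sub>R X)) has_derivative (\<lambda>h. 0)) (at s within UNIV)" for s
    using mexp_conjugation_has_vector_derivative[of X D s UNIV] assms
    by (simp add: has_vector_derivative_def matrix_mult.zero_left matrix_mult.zero_right)
  from has_derivative_zero_unique[OF convex_UNIV this, of _ 0]
  have "mexp (- (s *\<^sub>R X)) ** D ** mexp (s *\<^sub>R X) = D" for s
    by simp
  then show ?thesis
    by (simp add: dexp_left_def)
qed

text \<open>The two evaluations of \<open>dexp_left\<close> at the commutator are compared: one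
  vanishes with \<open>dexp_left X D\<close>, the other is the change of \<open>D\<close> under
  conjugation by \<open>mexp X\<close>.\<close>

lemma dexp_left_eq_0D:
  assumes "dexp_left X D = 0"
  shows "mexp X ** D = D ** mexp X"
proof -
  have "mexp (- X) ** D ** mexp X = D"
    using dexp_left_commutator[of X D] dexp_left_mult_commutator[of X D] assms
    by (simp add: matrix_mult.zero_left matrix_mult.zero_right)
  then show ?thesis
    by (metis matrix_mul_assoc matrix_mul_lid mexp_minus_mult(2))
qed

text \<open>Transposition exchanges \<open>mexp (s *\<^sub>R X)\<close> with its inverse when
  \<open>X\<close> is skew, so the conjugations under the integral keep their form.\<close>

lemma transpose_dexp_left:
  assumes "X \<in> so"
  shows "transpose (dexp_left X D) = dexp_left X (transpose D)"
proof -
  have "(\<lambda>s. mexp (- (s *\<^sub>R X)) ** D ** mexp (s *\<^sub>R X)) integrable_on {0..1}"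
    by (intro integrable_continuous_real matrix_mult.continuous_on continuous_intros)
  from integral_linear[OF this bounded_linear_transpose] assms show ?thesis
    by (simp add: dexp_left_def comp_def matrix_transpose_mul transpose_mexp transpose_uminus
        transpose_scalar so_def matrix_mul_assoc)
qed

section \<open>Skew-symmetric matrices of spectral norm below \<open>\<pi>\<close>\<close>

lemma inner_matrix_vector_mult_left: "(A *v x) \<bullet> y = x \<bullet> (transpose A *v y)"
  for A :: "real ^ 'n ^ 'm"
  by (metis dot_lmul_matrix vector_transpose_matrix)

lemma norm_mexp_skew:
  assumes "A \<in> so"
  shows "norm (mexp A *v v) = norm v"
proof -
  have "(mexp A *v v) \<bullet> (mexp A *v v) = v \<bullet> ((mexp (- A) ** mexp A) *v v)"
    using assms by (simp add: inner_matrix_vector_mult_left transpose_mexp so_def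
        del: transpose_matrix_vector) (simp add: matrix_vector_mul_assoc)
  then show ?thesis
    by (simp add: mexp_minus_mult norm_eq_sqrt_inner)
qed

lemma inner_skew_eq_0: "A \<in> so \<Longrightarrow> (A *v v) \<bullet> v = 0"
  using inner_matrix_vector_mult_left[of A v v] matrix_vector_mult_diff_rdistrib[of 0 A v]
  by (simp add: so_def inner_commute del: transpose_matrix_vector)

lemma so_scaleR: "A \<in> so \<Longrightarrow> c *\<^sub>R A \<in> so"
  by (simp add: so_def transpose_scalar)

lemma norm_matrix_vector_le_spectral_norm: "norm (A *v v) \<le> spectral_norm A * norm v"
  unfolding spectral_norm_def by (rule onorm) simp

lemma spectral_norm_scaleR: "spectral_norm (c *\<^sub>R A) = \<bar>c\<bar> * spectral_norm A"
  unfolding spectral_norm_def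
  using onorm_scaleR[of "(*v) A" c] by (simp add: scaleR_matrix_vector_assoc)

text \<open>The curve \<open>s \<mapsto> exp (s A) v\<close> on the unit sphere has speed at most the spectral norm of
  \<open>A\<close>, so that it travels less than a right angle up to \<open>s = 1/2\<close>.  The factor \<open>c < 1\<close> keeps
  the argument of \<open>arccos\<close> away from \<open>\<plusminus>1\<close>, where \<open>arccos\<close> is not differentiable.\<close>

lemma inner_mexp_skew_unit_pos:
  fixes v :: "real ^ 'n"
  assumes A: "A \<in> so" and lt: "spectral_norm A < pi" and v: "norm v = 1"
  shows "0 < v \<bullet> (mexp ((1/2) *\<^sub>R A) *v v)"
proof -
  define \<mu> where "\<mu> = spectral_norm A"
  have \<mu>0: "0 \<le> \<mu>"
    unfolding \<mu>_def spectral_norm_def by (rule onorm_pos_le) simp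
  define \<gamma> where "\<gamma> = (\<lambda>s. mexp (s *\<^sub>R A) *v v)"
  define g where "g = (\<lambda>s. v \<bullet> \<gamma> s)"
  \<comment> \<open>\<open>\<delta>\<close> is half the slack \<open>pi / 2 - \<mu> / 2\<close>. The
    damped angle \<open>arccos (c * g s)\<close> starts at \<open>\<delta>\<close>, and adding at
    most \<open>\<mu> / 2\<close> leaves it below a right angle.\<close>
  define \<delta> where "\<delta> = (pi / 2 - \<mu> / 2) / 2"
  define c where "c = cos \<delta>"
  have \<delta>: "0 < \<delta>" "\<delta> \<le> pi / 4"
    using lt \<mu>0 by (auto simp: \<delta>_def \<mu>_def)
  then have "cos \<delta> < cos 0" "cos (pi / 2) < cos \<delta>"
    by (intro cos_monotone_0_pi; simp)+
  then have c: "0 < c" "c < 1"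
    by (auto simp: c_def)
  have \<gamma>: "norm (\<gamma> s) = 1" for s
    using norm_mexp_skew[OF so_scaleR[OF A], of s v] v by (simp add: \<gamma>_def)
  have gle: "\<bar>g s\<bar> \<le> 1" for s
    using Cauchy_Schwarz_ineq2[of v "\<gamma> s"] v \<gamma>[of s] by (simp add: g_def)
  have cg: "\<bar>c * g s\<bar> < 1" for s
  proof -
    have "\<bar>c * g s\<bar> \<le> c * 1"
      unfolding abs_mult using c gle[of s] by (intro mult_mono) auto
    with c show ?thesis by simp
  qed
  have "bounded_linear (\<lambda>M :: real ^ 'n ^ 'n. v \<bullet> (M *v v))"
    by (intro bounded_linear_compose[OF bounded_linear_inner_right] linear_conv_bounded_linear[THEN iffD1] linearI)
      (simp_all add: algebra_simps scaleR_matrix_vector_assoc)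
  from bounded_linear.has_vector_derivative[OF this mexp_scaleR_has_vector_derivative[of A]]
  have dg: "(g has_real_derivative v \<bullet> (A *v \<gamma> s)) (at s)" for s
    by (simp add: g_def \<gamma>_def has_real_derivative_iff_has_vector_derivative matrix_vector_mul_assoc)
  \<comment> \<open>\<open>A *v \<gamma> s\<close> is orthogonal to \<open>\<gamma> s\<close>, so
    \<open>v\<close> may be replaced by its component orthogonal to \<open>\<gamma> s\<close>, whose
    length is \<open>sqrt (1 - (g s)\<^sup>2)\<close>.\<close>
  have speed: "\<bar>v \<bullet> (A *v \<gamma> s)\<bar> \<le> sqrt (1 - (g s)\<^sup>2) * \<mu>" for s
  proof -
    have "(norm (v - g s *\<^sub>R \<gamma> s))\<^sup>2 = v \<bullet> v - 2 * g s * (v \<bullet> \<gamma> s) + (g s)\<^sup>2 * (\<gamma> s \<bullet> \<gamma> s)"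
      unfolding power2_norm_eq_inner
      by (simp add: inner_diff_left inner_diff_right inner_commute algebra_simps power2_eq_square)
    also have "\<dots> = 1 - (g s)\<^sup>2"
      using v \<gamma>[of s] by (simp add: norm_eq_1 g_def power2_eq_square)
    finally have n: "norm (v - g s *\<^sub>R \<gamma> s) = sqrt (1 - (g s)\<^sup>2)"
      by (metis norm_ge_zero real_sqrt_unique)
    have "v \<bullet> (A *v \<gamma> s) = (v - g s *\<^sub>R \<gamma> s) \<bullet> (A *v \<gamma> s)"
      using inner_skew_eq_0[OF A, of "\<gamma> s"] by (simp add: inner_diff_left inner_commute[of "\<gamma> s"])
    also have "\<bar>\<dots>\<bar> \<le> norm (v - g s *\<^sub>R \<gamma> s) * norm (A *v \<gamma> s)"
      by (rule Cauchy_Schwarz_ineq2)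
    also have "\<dots> \<le> sqrt (1 - (g s)\<^sup>2) * \<mu>"
      unfolding n \<mu>_def using norm_matrix_vector_le_spectral_norm[of A "\<gamma> s"] \<gamma>[of s] gle[of s]
      by (intro mult_left_mono) (auto simp: abs_square_le_1)
    finally show ?thesis .
  qed
  define \<theta>' where "\<theta>' = (\<lambda>s. inverse (- sqrt (1 - (c * g s)\<^sup>2)) * (c * (v \<bullet> (A *v \<gamma> s))))"
  have d\<theta>: "((\<lambda>s. arccos (c * g s)) has_real_derivative \<theta>' s) (at s)" for s
    unfolding \<theta>'_def using cg[of s]
    by (intro DERIV_chain2[OF DERIV_arccos] DERIV_cmult dg) auto
  \<comment> \<open>Damping does not increase the speed bound:
    \<open>c * sqrt (1 - (g s)\<^sup>2)\<close> is at most
    \<open>sqrt (1 - (c * g s)\<^sup>2)\<close> because \<open>c < 1\<close>.\<close>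
  have \<theta>'le: "\<theta>' s \<le> \<mu>" for s
  proof -
    have pos: "0 < sqrt (1 - (c * g s)\<^sup>2)"
      using cg[of s] by (simp add: abs_square_less_1)
    have "\<bar>c * (v \<bullet> (A *v \<gamma> s))\<bar> \<le> c * (sqrt (1 - (g s)\<^sup>2) * \<mu>)"
      using c speed[of s] by (simp add: abs_mult)
    also have "\<dots> = sqrt (c\<^sup>2 - (c * g s)\<^sup>2) * \<mu>"
    proof -
      have "c\<^sup>2 - (c * g s)\<^sup>2 = c\<^sup>2 * (1 - (g s)\<^sup>2)"
        by (simp add: algebra_simps power_mult_distrib)
      then show ?thesis
        using c by (simp add: real_sqrt_mult)
    qed
    also have "\<dots> \<le> sqrt (1 - (c * g s)\<^sup>2) * \<mu>"
      using c \<mu>0 by (intro mult_right_mono) (auto simp: abs_square_le_1)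
    finally have "\<bar>c * (v \<bullet> (A *v \<gamma> s))\<bar> / sqrt (1 - (c * g s)\<^sup>2) \<le> \<mu>"
      using pos by (simp add: divide_le_eq mult.commute)
    moreover have "\<theta>' s \<le> \<bar>c * (v \<bullet> (A *v \<gamma> s))\<bar> / sqrt (1 - (c * g s)\<^sup>2)"
      using pos by (simp add: \<theta>'_def field_simps)
    ultimately show ?thesis
      by linarith
  qed
  obtain z where "arccos (c * g (1/2)) - arccos (c * g 0) = (1/2 - 0) * \<theta>' z"
    using MVT2[of 0 "1/2", OF _ d\<theta>] by auto
  moreover have "g 0 = 1"
    using v by (simp add: g_def \<gamma>_def norm_eq_1)
  moreover have "arccos c = \<delta>"
    unfolding c_def using \<delta> by (intro arccos_cos) auto
  ultimately have lt: "arccos (c * g (1/2)) < pi / 2"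
    using \<theta>'le[of z] lt by (simp add: \<delta>_def \<mu>_def field_simps)
  have "cos (pi / 2) < cos (arccos (c * g (1/2)))"
    using lt cg[of "1/2"] by (intro cos_monotone_0_pi arccos_lbound) auto
  then have "0 < c * g (1/2)"
    using cg[of "1/2"] by simp
  then show ?thesis
    using c by (simp add: zero_less_mult_iff g_def \<gamma>_def)
qed

lemma inner_mexp_skew_pos:
  fixes v :: "real ^ 'n"
  assumes "A \<in> so" "spectral_norm A < pi" "v \<noteq> 0"
  shows "0 < v \<bullet> (mexp ((1/2) *\<^sub>R A) *v v)"
proof -
  define u where "u = (1 / norm v) *\<^sub>R v"
  have "norm u = 1" "v = norm v *\<^sub>R u"
    using assms(3) by (simp_all add: u_def)
  then have "v \<bullet> (mexp ((1/2) *\<^sub>R A) *v v) = (norm v)\<^sup>2 * (u \<bullet> (mexp ((1/2) *\<^sub>R A) *v u))"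
    by (metis (no_types) inner_scaleR_left inner_scaleR_right matrix_vector_mult_scaleR mult.assoc power2_eq_square)
  with inner_mexp_skew_unit_pos[OF assms(1,2) \<open>norm u = 1\<close>] assms(3) show ?thesis
    by simp
qed

section \<open>Sylvester equations and the halving of intertwining relations\<close>

lemma inner_transpose: "transpose A \<bullet> transpose B = A \<bullet> (B :: real ^ 'n ^ 'm)"
  unfolding inner_vec_def transpose_def by simp (rule sum.swap)

text \<open>The inner product of matrices is a sum over rows, and row \<open>i\<close> contributes
  the quadratic form of \<open>Q\<close> at \<open>D $ i\<close>.\<close>

lemma inner_mult_right_pos:
  fixes D Q :: "real ^ 'n ^ 'n"
  assumes "\<And>v. v \<noteq> 0 \<Longrightarrow> 0 < v \<bullet> (Q *v v)" and "D \<noteq> 0"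
  shows "0 < D \<bullet> (D ** Q)"
proof -
  have row: "(D ** Q) $ i = D $ i v* Q" for i
    by (simp add: matrix_matrix_mult_def vector_matrix_mult_def vec_eq_iff mult.commute)
  have eq: "D \<bullet> (D ** Q) = (\<Sum>i\<in>UNIV. D $ i \<bullet> (Q *v D $ i))"
    unfolding inner_vec_def[of D] row
    by (intro sum.cong refl) (metis dot_lmul_matrix inner_commute)
  obtain i where "D $ i \<noteq> 0"
    using assms(2) by (auto simp: vec_eq_iff)
  moreover have "0 \<le> D $ j \<bullet> (Q *v D $ j)" for j
    using assms(1)[of "D $ j"] by (cases "D $ j = 0") auto
  ultimately show ?thesis
    unfolding eq by (intro sum_pos2[of _ i]) (auto intro: assms(1))
qed

text \<open>Transposing reduces this to multiplication on the right, since
  \<open>transpose P\<close> has the same quadratic form as \<open>P\<close>.\<close>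

lemma inner_mult_left_pos:
  fixes D P :: "real ^ 'n ^ 'n"
  assumes "\<And>v. v \<noteq> 0 \<Longrightarrow> 0 < v \<bullet> (P *v v)" and "D \<noteq> 0"
  shows "0 < D \<bullet> (P ** D)"
proof -
  have "transpose D \<noteq> 0"
    using assms(2) by (metis linear_0 linear_transpose transpose_transpose)
  moreover have "v \<bullet> (transpose P *v v) = v \<bullet> (P *v v)" for v
    by (metis inner_commute inner_matrix_vector_mult_left)
  ultimately have "0 < transpose D \<bullet> (transpose D ** transpose P)"
    by (intro inner_mult_right_pos) (use assms(1) in \<open>simp_all del: transpose_matrix_vector\<close>)
  then show ?thesis
    by (simp add: inner_transpose flip: matrix_transpose_mul)
qed

text \<open>Pairing the equation with \<open>D\<close> itself would give a positive number if
  \<open>D\<close> were nonzero.\<close>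

lemma sylvester_unique:
  fixes P Q D :: "real ^ 'n ^ 'n"
  assumes "\<And>v. v \<noteq> 0 \<Longrightarrow> 0 < v \<bullet> (P *v v)" "\<And>v. v \<noteq> 0 \<Longrightarrow> 0 < v \<bullet> (Q *v v)"
    and "P ** D + D ** Q = 0"
  shows "D = 0"
proof (rule ccontr)
  assume "D \<noteq> 0"
  then have "0 < D \<bullet> (P ** D) + D \<bullet> (D ** Q)"
    using inner_mult_left_pos[OF assms(1)] inner_mult_right_pos[OF assms(2)] by (simp add: add_pos_pos)
  then show False
    using assms(3) by (simp flip: inner_add_right)
qed

text \<open>With \<open>S = exp (A/2)\<close>, the matrix \<open>S + S\<^sup>-\<^sup>1\<close> is the positive definite square root of
  \<open>exp A + 2 + exp (-A)\<close>, and \<open>(S + S\<^sup>-\<^sup>1) S = exp A + 1\<close>; hence \<open>S\<close> is determined by \<open>exp A\<close>.\<close>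

lemma mexp_intertwine_half:
  fixes A B D :: "real ^ 'n ^ 'n"
  assumes A: "A \<in> so" "spectral_norm A < pi" and B: "B \<in> so" "spectral_norm B < pi"
    and eq: "mexp A ** D = D ** mexp B"
  shows "mexp ((1/2) *\<^sub>R A) ** D = D ** mexp ((1/2) *\<^sub>R B)"
proof -
  define root where "root = (\<lambda>A :: real ^ 'n ^ 'n. mexp ((1/2) *\<^sub>R A) + mexp (- ((1/2) *\<^sub>R A)))"
  have pos: "0 < v \<bullet> (root A *v v)" if "A \<in> so" "spectral_norm A < pi" "v \<noteq> 0" for A v
  proof -
    have "v \<bullet> (mexp (- ((1/2) *\<^sub>R A)) *v v) = v \<bullet> (mexp ((1/2) *\<^sub>R A) *v v)"
      using that(1) inner_matrix_vector_mult_left[of "mexp ((1/2) *\<^sub>R A)" v v]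
      by (simp add: transpose_mexp transpose_scalar so_def inner_commute del: transpose_matrix_vector)
    then show ?thesis
      using inner_mexp_skew_pos[OF that]
      by (simp add: root_def matrix_vector_mult_add_rdistrib inner_add_right)
  qed
  have sq: "root A ** root A = mexp A + mexp (- A) + 2 *\<^sub>R mat 1" for A
    using mexp_half_mult[of A] mexp_half_mult[of "- A"] mexp_minus_mult[of "(1/2) *\<^sub>R A"]
    by (simp add: root_def matrix_mult.add_left matrix_mult.add_right scaleR_2)
  have root_mult: "root A ** mexp ((1/2) *\<^sub>R A) = mexp A + mat 1" for A
    using mexp_half_mult[of A] mexp_minus_mult[of "(1/2) *\<^sub>R A"]
    by (simp add: root_def matrix_mult.add_left)
  have "mexp (- A) ** D = D ** mexp (- B)"
    using eq by (metis matrix_mul_assoc matrix_mul_lid matrix_mul_rid mexp_minus_mult)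
  with eq have sq_eq: "root A ** root A ** D = D ** (root B ** root B)"
    by (simp add: sq matrix_mult.add_left matrix_mult.add_right
        matrix_mult.scaleR_left matrix_mult.scaleR_right)
  \<comment> \<open>In the Sylvester equation for this difference the mixed terms cancel, leaving
    the intertwining of the squares, \<open>sq_eq\<close>.\<close>
  have "root A ** D - D ** root B = 0"
  proof (rule sylvester_unique[of "root A" "root B"])
    show "root A ** (root A ** D - D ** root B) + (root A ** D - D ** root B) ** root B = 0"
      using sq_eq by (simp add: matrix_mult.diff_left matrix_mult.diff_right matrix_mul_assoc)
  qed (use pos A B in auto)
  then have root_eq: "root A ** D = D ** root B"
    by simp
  let ?W = "mexp ((1/2) *\<^sub>R A) ** D - D ** mexp ((1/2) *\<^sub>R B)"
  have "root A ** ?W = (root A ** mexp ((1/2) *\<^sub>R A)) ** D - (root A ** D) ** mexp ((1/2) *\<^sub>R B)"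
    by (simp add: matrix_mult.diff_right matrix_mul_assoc)
  also have "\<dots> = (root A ** mexp ((1/2) *\<^sub>R A)) ** D - D ** (root B ** mexp ((1/2) *\<^sub>R B))"
    by (simp add: root_eq matrix_mul_assoc)
  also have "\<dots> = 0"
    using eq by (simp add: root_mult matrix_mult.add_left matrix_mult.add_right)
  \<comment> \<open>Positive definiteness of \<open>root A\<close> makes left multiplication by it
    injective.\<close>
  finally have "?W = 0"
    using inner_mult_left_pos[OF pos[OF A], of ?W] by fastforce
  then show ?thesis
    by simp
qed

lemma mexp_intertwine:
  fixes A B D :: "real ^ 'n ^ 'n"
  assumes A: "A \<in> so" "spectral_norm A < pi" and B: "B \<in> so" "spectral_norm B < pi"
    and eq: "mexp A ** D = D ** mexp B"
  shows "A ** D = D ** B"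
proof -
  define h where "h = (\<lambda>k. (1/2 :: real) ^ k)"
  have le: "spectral_norm (h k *\<^sub>R C) < pi" if "spectral_norm C < pi" for k and C :: "real ^ 'n ^ 'n"
  proof -
    have "h k * spectral_norm C \<le> 1 * spectral_norm C"
      unfolding spectral_norm_def by (intro mult_right_mono onorm_pos_le) (simp_all add: h_def power_le_one)
    with that show ?thesis
      by (simp add: spectral_norm_scaleR h_def)
  qed
  \<comment> \<open>Scaling by \<open>h k\<close> keeps the spectral norms below \<open>pi\<close>,
    so the halving lemma applies again at every stage.\<close>
  have heq: "mexp (h k *\<^sub>R A) ** D = D ** mexp (h k *\<^sub>R B)" for k
  proof (induction k)
    case (Suc k)
    have "h (Suc k) *\<^sub>R C = (1/2) *\<^sub>R (h k *\<^sub>R C)" for C :: "real ^ 'n ^ 'n"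
      by (simp add: h_def)
    then show ?case
      using mexp_intertwine_half[OF so_scaleR[OF A(1)] le[OF A(2)] so_scaleR[OF B(1)] le[OF B(2)] Suc]
      by metis
  qed (use eq in \<open>simp add: h_def\<close>)
  define F where "F = (\<lambda>s. mexp (s *\<^sub>R A) ** D - D ** mexp (s *\<^sub>R B))"
  have "(F has_vector_derivative (A ** mexp (0 *\<^sub>R A)) ** D - D ** (B ** mexp (0 *\<^sub>R B))) (at 0)"
    unfolding F_def
    by (intro has_vector_derivative_diff
        bounded_linear.has_vector_derivative[OF matrix_mult.bounded_linear_left]
        bounded_linear.has_vector_derivative[OF matrix_mult.bounded_linear_right]
        mexp_scaleR_has_vector_derivative)
  then have "((\<lambda>s. norm (F s - F 0 - s *\<^sub>R (A ** D - D ** B)) / \<bar>s\<bar>) \<longlongrightarrow> 0) (at 0)"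
    by (simp add: has_vector_derivative_def has_derivative_iff_norm)
  moreover have "filterlim h (at 0) sequentially"
    unfolding filterlim_at
    by (auto simp: h_def intro!: LIMSEQ_power_zero)
  ultimately have "(\<lambda>k. norm (F (h k) - F 0 - h k *\<^sub>R (A ** D - D ** B)) / \<bar>h k\<bar>) \<longlonglongrightarrow> 0"
    by (rule filterlim_compose)
  \<comment> \<open>As \<open>F\<close> vanishes along \<open>h\<close>, the quotient there is
    constantly \<open>norm (A ** D - D ** B)\<close>, which must equal its limit
    \<open>0\<close>.\<close>
  moreover have "F (h k) = 0" "F 0 = 0" "h k \<noteq> 0" for k
    using heq[of k] by (simp_all add: F_def h_def)
  ultimately have "(\<lambda>k. norm (A ** D - D ** B)) \<longlonglongrightarrow> 0"
    by simp
  then show ?thesis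
    by (simp add: LIMSEQ_const_iff)
qed

section \<open>The logarithm\<close>

lemma inj_on_mexp: "inj_on mexp {A :: real ^ 'n ^ 'n. A \<in> so \<and> spectral_norm A < pi}"
proof (rule inj_onI, clarify)
  fix A B :: "real ^ 'n ^ 'n"
  assume "A \<in> so" "spectral_norm A < pi" "B \<in> so" "spectral_norm B < pi" "mexp A = mexp B"
  then show "A = B"
    using mexp_intertwine[of A B "mat 1"] by simp
qed

lemma inj_dexp_left:
  assumes "X \<in> so" "spectral_norm X < pi"
  shows "inj (dexp_left X)"
proof -
  have "D = 0" if "dexp_left X D = 0" for D
  proof -
    have "X ** D = D ** X"
      by (rule mexp_intertwine[OF assms assms dexp_left_eq_0D[OF that]])
    with that show ?thesis
      using dexp_left_of_commuting[of D X] by simp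
  qed
  then show ?thesis
    using linear_dexp_left linear_injective_0 by blast
qed

text \<open>\<open>dexp_left X\<close> commutes with the involution \<open>D \<mapsto> - D\<^sup>T\<close>, whose fixed points are \<open>so\<close>.\<close>

lemma bij_betw_dexp_left:
  fixes X :: "real ^ 'n ^ 'n"
  assumes X: "X \<in> so" "spectral_norm X < pi"
  shows "bij_betw (dexp_left X) so so"
proof -
  have inj: "inj (dexp_left X)"
    by (rule inj_dexp_left[OF X])
  have surj: "surj (dexp_left X)"
    by (rule linear_injective_imp_surjective[OF linear_dexp_left inj]) (rule refl)
  \<comment> \<open>Skewness of the image says that \<open>transpose D\<close> and
    \<open>- D\<close> have the same image; injectivity removes \<open>dexp_left X\<close>.\<close>
  have so_iff: "dexp_left X D \<in> so \<longleftrightarrow> D \<in> so" for D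
    using inj_eq[OF inj, of "transpose D" "- D"]
    by (simp add: so_def transpose_dexp_left[OF X(1)] linear_neg[OF linear_dexp_left])
  have "dexp_left X ` so = so"
  proof (intro equalityI subsetI)
    fix Y :: "real ^ 'n ^ 'n"
    assume "Y \<in> so"
    moreover obtain D where "Y = dexp_left X D"
      using surjD[OF surj] by blast
    ultimately show "Y \<in> dexp_left X ` so"
      using so_iff by blast
  qed (use so_iff in auto)
  with inj show ?thesis
    by (auto simp: bij_betw_def intro: inj_on_subset)
qed

section \<open>The logarithm and its local differentiability\<close>

lemma hat_image_log_coords:
  assumes "hat_map hat"
  shows "hat ` log_coords hat = {A. A \<in> so \<and> spectral_norm A < pi}"
  using assms by (auto simp: hat_map_def log_coords_def bij_betw_def)

lemma Log_mexp:
  assumes "hat_map hat" "A \<in> so" "spectral_norm A < pi"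
  shows "Log hat (mexp A) = A"
  unfolding Log_def hat_image_log_coords[OF assms(1)]
  using assms by (intro the_inv_into_f_f inj_on_mexp) simp

text \<open>A finite convex function on a finite-dimensional space is continuous.\<close>

lemma continuous_on_spectral_norm:
  "continuous_on UNIV (spectral_norm :: real ^ 'n ^ 'n \<Rightarrow> real)"
proof (rule convex_on_continuous)
  have add: "spectral_norm (A + B) \<le> spectral_norm A + spectral_norm B" for A B :: "real ^ 'n ^ 'n"
    using onorm_triangle[of "(*v) A" "(*v) B"]
    by (simp add: spectral_norm_def matrix_vector_mult_add_rdistrib[abs_def])
  show "convex_on UNIV (spectral_norm :: real ^ 'n ^ 'n \<Rightarrow> real)"
  proof (rule convex_onI)
    show "spectral_norm ((1 - t) *\<^sub>R A + t *\<^sub>R B) \<le> (1 - t) * spectral_norm A + t * spectral_norm B"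
      if "0 < t" "t < 1" for t and A B :: "real ^ 'n ^ 'n"
      using add[of "(1 - t) *\<^sub>R A" "t *\<^sub>R B"] that by (simp add: spectral_norm_scaleR)
  qed simp
qed simp

text \<open>Orthogonality makes \<open>mexp (transpose Y)\<close> the inverse of
  \<open>mexp Y\<close>, and its inverse is also \<open>mexp (- transpose Y)\<close>.\<close>

lemma mexp_minus_transpose:
  assumes "mexp Y \<in> SO"
  shows "mexp (- transpose Y) = mexp Y"
proof -
  have "mexp (transpose Y) ** mexp Y = mat 1"
    using assms by (simp add: SO_def transpose_mexp)
  then show ?thesis
    by (metis matrix_mul_assoc matrix_mul_lid matrix_mul_rid mexp_minus_mult(1))
qed

text \<open>The local inverse of the exponential on all matrices is differentiable.  It maps rotations
  to skew-symmetric matrices because \<open>Y\<close> and \<open>- Y\<^sup>T\<close> have the same exponential if it is a rotation.\<close>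

lemma Log_locally_differentiable:
  fixes X :: "real ^ 'n ^ 'n"
  assumes hat: "hat_map hat" and X: "X \<in> so" "spectral_norm X < pi"
  obtains g g' where "(g has_derivative g') (at (mexp X))"
    "\<And>D. g' (mexp X ** dexp_left X D) = D"
    "\<forall>\<^sub>F S in nhds (mexp X). S \<in> SO \<longrightarrow> Log hat S = g S"
proof -
  have inj: "inj (mexp_slope X X)"
  proof (rule injI)
    fix D E
    assume "mexp_slope X X D = mexp_slope X X E"
    then have "mexp (- X) ** (mexp X ** dexp_left X D) = mexp (- X) ** (mexp X ** dexp_left X E)"
      by (simp add: mexp_slope_diag)
    then show "D = E"
      using inj_dexp_left[OF X] by (simp add: matrix_mul_assoc mexp_minus_mult inj_eq)
  qed
  \<comment> \<open>Injectivity supplies the linear left inverse that the inverse function theorem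
    asks for at \<open>X\<close>.\<close>
  have "linear (mexp_slope X X)"
    by (simp add: bounded_linear.linear blinfun.bounded_linear_right)
  then obtain L where L: "linear L" "L \<circ> mexp_slope X X = id"
    using linear_injective_left_inverse inj by blast
  have inv: "Blinfun L o\<^sub>L mexp_slope X X = id_blinfun"
    using L by (intro blinfun_eqI)
      (simp add: bounded_linear_Blinfun_apply linear_conv_bounded_linear[symmetric] pointfree_idE)
  have cont: "continuous_on UNIV (\<lambda>A :: real ^ 'n ^ 'n. mexp_slope A A)"
    using continuous_on_compose2[OF continuous_on_mexp_slope, of UNIV "\<lambda>A. (A, A)"]
    by (simp add: continuous_on_Pair)
  obtain U V g g' where U: "open U" "X \<in> U" and V: "open V" "mexp X \<in> V"
    and h: "homeomorphism U V mexp g"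
    and dg: "\<And>y. y \<in> V \<Longrightarrow> (g has_derivative g' y) (at y)"
    and g': "\<And>y. y \<in> V \<Longrightarrow> g' y = inv (blinfun_apply (mexp_slope (g y) (g y)))"
    by (rule inverse_function_theorem[OF open_UNIV mexp_has_derivative cont UNIV_I inv]) blast
  have gX: "g (mexp X) = X"
    using h U by (simp add: homeomorphism_def)
  show ?thesis
  proof
    show "(g has_derivative g' (mexp X)) (at (mexp X))"
      by (rule dg[OF V(2)])
    show "g' (mexp X) (mexp X ** dexp_left X D) = D" for D
      using inv_f_f[OF inj, of D] by (simp add: g'[OF V(2)] gX flip: mexp_slope_diag)
    \<comment> \<open>On \<open>W\<close> both \<open>Y\<close> and \<open>- transpose Y\<close> lie
      in \<open>U\<close>, where \<open>mexp\<close> is injective, and the spectral norm is in the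
      range of \<open>Log\<close>. \<open>X\<close> lies in \<open>W\<close> since it equals
      \<open>- transpose X\<close>.\<close>
    define W where "W = U \<inter> (\<lambda>Y. - transpose Y) -` U \<inter> spectral_norm -` {..<pi}"
    have "open W"
      unfolding W_def
      by (intro open_Int U open_vimage open_lessThan continuous_on_spectral_norm continuous_on_minus
          linear_continuous_on bounded_linear_transpose)
    moreover have "X \<in> W"
      using X U by (simp add: W_def so_def)
    moreover have "isCont g (mexp X)"
      using dg[OF V(2)] has_derivative_continuous by blast
    ultimately have "\<forall>\<^sub>F S in nhds (mexp X). g S \<in> W"
      using gX by (metis topological_tendstoD tendsto_at_iff_tendsto_nhds isCont_def)
    moreover have "\<forall>\<^sub>F S in nhds (mexp X). S \<in> V"
      by (rule eventually_nhds_in_open[OF V])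
    ultimately show "\<forall>\<^sub>F S in nhds (mexp X). S \<in> SO \<longrightarrow> Log hat S = g S"
    proof eventually_elim
      case (elim S)
      show ?case
      proof
        assume "S \<in> SO"
        have S: "mexp (g S) = S"
          using h elim(2) by (simp add: homeomorphism_def)
        have "mexp (- transpose (g S)) = mexp (g S)"
          by (rule mexp_minus_transpose) (use S \<open>S \<in> SO\<close> in simp)
        then have "- transpose (g S) = g S"
          using h elim(1) by (metis (no_types, lifting) Int_iff W_def homeomorphism_apply1 vimageD)
        then have "g S \<in> so"
          by (simp add: so_def equation_minus_iff eq_commute)
        then show "Log hat S = g S"
          using Log_mexp[OF hat, of "g S"] S elim(1) by (simp add: W_def)
      qed
    qed
  qed
qed

theorem proposition4:
  fixes hat :: "real ^ 'm \<Rightarrow> real ^ 'n ^ 'n"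
    and \<X> :: "(real ^ 'm) set"
    and f :: "real ^ 'm \<Rightarrow> real ^ 'n ^ 'n \<Rightarrow> real ^ 'm"
    and R X :: "real \<Rightarrow> real ^ 'n ^ 'n"
    and x :: "real \<Rightarrow> real ^ 'm"
    and t :: real
  assumes "CARD('n) \<ge> 2"
    and "CARD('m) = CARD('n) * (CARD('n) - 1) div 2"
    and "hat_map hat"
    and "compact \<X>" and "connected \<X>" and "0 \<in> \<X>"
    and "unique_forward_complete hat \<X> f"
    and "trajectory hat \<X> f R x"
    and "X = (\<lambda>s. Log hat (R s))"
    and "t \<ge> 0"
    and "R t \<in> SO_reg hat"
  shows "linear (dexp_left (X t)) \<and>
    bij_betw (dexp_left (X t)) so so \<and>
    (X has_vector_derivative the_inv_into so (dexp_left (X t)) (hat (x t))) (at t within {0..})"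
proof (intro conjI)
  show "linear (dexp_left (X t))"
    by (rule linear_dexp_left)
  note hat = \<open>hat_map hat\<close>
  obtain \<omega> where \<omega>: "\<omega> \<in> log_coords hat" "R t = mexp (hat \<omega>)"
    using \<open>R t \<in> SO_reg hat\<close> by (auto simp: SO_reg_def)
  have hat\<omega>: "hat \<omega> \<in> so" "spectral_norm (hat \<omega>) < pi"
    using \<omega>(1) hat_image_log_coords[OF hat] by blast+
  have Xt: "X t = hat \<omega>"
    using Log_mexp[OF hat hat\<omega>] \<omega>(2) \<open>X = _\<close> by simp
  show bij: "bij_betw (dexp_left (X t)) so so"
    unfolding Xt by (rule bij_betw_dexp_left[OF hat\<omega>])
  define D where "D = the_inv_into so (dexp_left (X t)) (hat (x t))"
  have "hat (x t) \<in> so"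
    using hat by (auto simp: hat_map_def bij_betw_def)
  then have D: "dexp_left (X t) D = hat (x t)"
    unfolding D_def by (rule f_the_inv_into_f_bij_betw[OF bij])
  obtain g g' where dg: "(g has_derivative g') (at (R t))"
    and g': "\<And>D. g' (R t ** dexp_left (X t) D) = D"
    and Log: "\<forall>\<^sub>F S in nhds (R t). S \<in> SO \<longrightarrow> Log hat S = g S"
    by (rule Log_locally_differentiable[OF hat hat\<omega>, folded \<omega>(2) Xt]) blast
  have R: "R s \<in> SO" if "s \<ge> 0" for s
    using \<open>trajectory hat \<X> f R x\<close> that by (simp add: trajectory_def)
  have dR: "(R has_derivative (\<lambda>h. h *\<^sub>R (R t ** hat (x t)))) (at t within {0..})"
    using \<open>trajectory hat \<X> f R x\<close> \<open>t \<ge> 0\<close> by (simp add: trajectory_def has_vector_derivative_def)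
  have "((\<lambda>s. g (R s)) has_derivative (\<lambda>h. g' (h *\<^sub>R (R t ** hat (x t))))) (at t within {0..})"
    by (rule has_derivative_compose[OF dR dg])
  then have "((\<lambda>s. g (R s)) has_derivative (\<lambda>h. h *\<^sub>R D)) (at t within {0..})"
    using g'[of D] by (simp add: D linear_scale[OF has_derivative_linear[OF dg]])
  \<comment> \<open>Near \<open>R t\<close> the local inverse \<open>g\<close> agrees with
    \<open>Log\<close> on \<open>SO\<close> only; the trajectory stays there for nonnegative times,
    which the filter \<open>at t within {0..}\<close> enforces.\<close>
  moreover have "\<forall>\<^sub>F s in at t within {0..}. g (R s) = X s"
  proof -
    have "filterlim R (nhds (R t)) (at t within {0..})"
      using has_derivative_continuous[OF dR] by (simp add: continuous_within)
    with Log have "\<forall>\<^sub>F s in at t within {0..}. R s \<in> SO \<longrightarrow> Log hat (R s) = g (R s)"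
      by (rule eventually_compose_filterlim)
    moreover have "\<forall>\<^sub>F s in at t within {0..}. s \<in> {0..}"
      by (simp add: eventually_at_filter)
    ultimately show ?thesis
      by eventually_elim (simp add: R \<open>X = _\<close>)
  qed
  moreover have "g (R t) = X t"
    using eventually_nhds_x_imp_x[OF Log] R \<open>t \<ge> 0\<close> \<open>X = _\<close> by simp
  moreover have "t \<in> {0..}"
    using \<open>t \<ge> 0\<close> by simp
  ultimately have "(X has_derivative (\<lambda>h. h *\<^sub>R D)) (at t within {0..})"
    by (rule has_derivative_transform_eventually)
  then show "(X has_vector_derivative the_inv_into so (dexp_left (X t)) (hat (x t))) (at t within {0..})"
    by (simp add: has_vector_derivative_def D_def)
qed

end
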